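(* Let $n\ge1$ and let $M\colon[-1,0]\to\mathcal M_n(\mathbb{R})$ be continuous from the right on $(-1,0)$. Assume that $M\in\mathcal W$, i.e. $M$ is of bounded variation and $\det(I-A_M)\neq0$, where $A_M=M(0)-M(0^-)$. Then, for every $\phi\in\mathcal C_0$, there exists a unique global solution $x\colon[-1,+\infty)\to\mathbb{R}^n$ of $$x(t)=\int_{-1}^0 \mathrm{d}M(\theta)\,x(t+\theta)$$ with initial condition $x_0=\phi$.
   Context: $\mathcal M_n(\mathbb{R})$ is the set of real $n\times n$ matrices, $I$ is the identity matrix, and $M(0^-)$ is the left-sided limit of $M$ at $0$. $M$ is of bounded variation if $\sup_P\sum_{i}\|M(t_{i+1})-M(t_i)\|<+\infty$, the supremum being over all partitions $P=\{[t_i,t_{i+1}]\}$ of $[-1,0]$ and $\|\cdot\|$ being a matrix norm induced by a norm on $\mathbb{R}^n$ (the notion does not depend on the norm). The integral is in the Riemann--Stieltjes sense. A global solution of the equation is a continuous function $x\colon[-1,+\infty)\to\mathbb{R}^n$ satisfying the equation for all $t\ge0$. Its initial condition is $x_0$, the restriction of $x$ to $[-1,0]$. The set of admissible initial conditions is $$\mathcal C_0=\Bigl\{\eta\in C([-1,0];\mathbb{R}^n) : \eta(0)=\int_{-1}^0\mathrm{d}M(\theta)\,\eta(\theta)\Bigr\}.$$ *)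

theory Defs
  imports "HOL-Analysis.Analysis"
begin

text \<open>
  Functions on \<open>[-1,0]\<close> and \<open>[-1,\<infinity>)\<close> are represented by total functions on the reals; none of the
  definitions below depends on values outside these domains. An interval \<open>K = [s,t]\<close> of a
  (tagged) division has \<open>Inf K = s\<close> and \<open>Sup K = t\<close>; the degenerate intervals that
  \<^const>\<open>division_of\<close> and \<^const>\<open>tagged_division_of\<close> allow contribute \<open>0\<close> to the sums.
\<close>

text \<open>
  Bounded variation with respect to the matrix norm induced by the Euclidean norm.
\<close>

definition bounded_variation_on :: "real \<Rightarrow> real \<Rightarrow> (real \<Rightarrow> real^'n^'n) \<Rightarrow> bool" where
  "bounded_variation_on a b M \<longleftrightarrow>
     bdd_above {\<Sum>K\<in>P. onorm (\<lambda>v. (M (Sup K) - M (Inf K)) *v v) | P. P division_of {a..b}}"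

text \<open>
  \<open>has_RS_integral a b M f I\<close>: the Riemann--Stieltjes integral of \<open>dM(\<theta>) f(\<theta>)\<close> over \<open>[a,b]\<close>
  exists, as a limit for the mesh tending to \<open>0\<close> (a uniform \<open>\<delta>\<close>, not a gauge), and equals \<open>I\<close>.
\<close>

definition has_RS_integral ::
    "real \<Rightarrow> real \<Rightarrow> (real \<Rightarrow> real^'n^'n) \<Rightarrow> (real \<Rightarrow> real^'n) \<Rightarrow> real^'n \<Rightarrow> bool" where
  "has_RS_integral a b M f I \<longleftrightarrow>
     (\<forall>\<epsilon>>0. \<exists>\<delta>>0. \<forall>p. p tagged_division_of {a..b} \<and> (\<forall>(\<xi>, K)\<in>p. Sup K - Inf K < \<delta>) \<longrightarrow>
        norm ((\<Sum>(\<xi>, K)\<in>p. (M (Sup K) - M (Inf K)) *v f \<xi>) - I) < \<epsilon>)"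

text \<open>
  The limit \<open>M(0\<^sup>-)\<close> exists whenever \<open>M\<close> has bounded variation on \<open>[-1,0]\<close>.
\<close>

definition jump_at_0 :: "(real \<Rightarrow> real^'n^'n) \<Rightarrow> real^'n^'n" where
  "jump_at_0 M = M 0 - Lim (at_left 0) M"

definition class_W :: "(real \<Rightarrow> real^'n^'n) set" where
  "class_W = {M. bounded_variation_on (-1) 0 M \<and> det (mat 1 - jump_at_0 M) \<noteq> 0}"

definition admissible_initial :: "(real \<Rightarrow> real^'n^'n) \<Rightarrow> (real \<Rightarrow> real^'n) set" where
  "admissible_initial M =
     {\<eta>. continuous_on {-1..0} \<eta> \<and> has_RS_integral (-1) 0 M \<eta> (\<eta> 0)}"

definition global_solution :: "(real \<Rightarrow> real^'n^'n) \<Rightarrow> (real \<Rightarrow> real^'n) \<Rightarrow> bool" where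
  "global_solution M x \<longleftrightarrow>
     continuous_on {-1..} x \<and> (\<forall>t\<ge>0. has_RS_integral (-1) 0 M (\<lambda>\<theta>. x (t + \<theta>)) (x t))"

definition has_initial_condition :: "(real \<Rightarrow> real^'n) \<Rightarrow> (real \<Rightarrow> real^'n) \<Rightarrow> bool" where
  "has_initial_condition x \<phi> \<longleftrightarrow> (\<forall>\<theta>\<in>{-1..0}. x \<theta> = \<phi> \<theta>)"

end

theory Submission
  imports Defs
begin

text \<open>
  Move the jump \<open>A\<close> of \<open>M\<close> at \<open>0\<close> to the left-hand side: with \<open>N = M\<close> except \<open>N(0) = M(0\<^sup>-)\<close>, the
  equation becomes \<open>x(t) = (I - A)\<^sup>-\<^sup>1 \<integral> dN(\<theta>) x(t + \<theta>)\<close>. The variation of \<open>N\<close> on \<open>[-r,0]\<close> tends to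
  \<open>0\<close> with \<open>r\<close>, so for large \<open>l\<close> the right-hand side is a contraction in the norm
  \<open>sup exp(-l t) |x(t)|\<close> on all of \<open>[0,\<infinity>)\<close>. This yields a solution in one application of the
  Banach fixed point theorem. Uniqueness needs no growth condition, since the same estimate applies
  to the difference of two solutions on each \<open>[0,T]\<close>.
\<close>

section \<open>Riemann--Stieltjes integrals against a dominated integrator\<close>

text \<open>The function \<open>v\<close> plays the role of the variation \<open>t \<mapsto> Var(M; [a,t])\<close>.\<close>

definition dominated_on :: "real \<Rightarrow> real \<Rightarrow> (real \<Rightarrow> real^'n^'n) \<Rightarrow> (real \<Rightarrow> real) \<Rightarrow> bool" where
  "dominated_on a b M v \<longleftrightarrow>
     (\<forall>s t u. a \<le> s \<longrightarrow> s \<le> t \<longrightarrow> t \<le> b \<longrightarrow> norm ((M t - M s) *v u) \<le> (v t - v s) * norm u)"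

definition RS_sum :: "(real \<Rightarrow> real^'n^'n) \<Rightarrow> (real \<Rightarrow> real^'n) \<Rightarrow> (real \<times> real set) set \<Rightarrow> real^'n" where
  "RS_sum M f p = (\<Sum>(\<xi>, K)\<in>p. (M (Sup K) - M (Inf K)) *v f \<xi>)"

definition mesh_below :: "real \<Rightarrow> (real \<times> real set) set \<Rightarrow> bool" where
  "mesh_below \<delta> p \<longleftrightarrow> (\<forall>(\<xi>, K)\<in>p. Sup K - Inf K < \<delta>)"

lemma has_RS_integral_alt:
  "has_RS_integral a b M f I \<longleftrightarrow>
     (\<forall>\<epsilon>>0. \<exists>\<delta>>0. \<forall>p. p tagged_division_of {a..b} \<and> mesh_below \<delta> p \<longrightarrow> norm (RS_sum M f p - I) < \<epsilon>)"
  by (simp add: has_RS_integral_def RS_sum_def mesh_below_def)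

lemma mesh_belowD: "mesh_below \<delta> p \<Longrightarrow> (\<xi>, K) \<in> p \<Longrightarrow> Sup K - Inf K < \<delta>"
  by (auto simp: mesh_below_def)

lemma mesh_below_mono: "mesh_below \<delta> p \<Longrightarrow> \<delta> \<le> \<delta>' \<Longrightarrow> mesh_below \<delta>' p"
  unfolding mesh_below_def by (auto intro: less_le_trans)

lemma dominated_onD:
  "dominated_on a b M v \<Longrightarrow> a \<le> s \<Longrightarrow> s \<le> t \<Longrightarrow> t \<le> b \<Longrightarrow>
     norm ((M t - M s) *v u) \<le> (v t - v s) * norm u"
  by (auto simp: dominated_on_def)

lemma dominated_on_mono:
  fixes M :: "real \<Rightarrow> real^'n^'n"
  assumes "dominated_on a b M v" "a \<le> s" "s \<le> t" "t \<le> b"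
  shows "v s \<le> v t"
proof -
  obtain u :: "real^'n" where "norm u = 1"
    using vector_choose_size[of 1] by auto
  then show ?thesis
    using order_trans[OF norm_ge_zero dominated_onD[OF assms, of u]] by simp
qed

lemma tagged_division_interval:
  fixes a b :: real
  assumes "p tagged_division_of {a..b}" "(\<xi>, K) \<in> p"
  shows "Inf K \<in> K" "Sup K \<in> K" "Inf K \<le> \<xi>" "\<xi> \<le> Sup K" "a \<le> Inf K" "Sup K \<le> b"
proof -
  obtain c d where K: "K = {c..d}"
    using tagged_division_ofD(4)[OF assms] by auto
  have "\<xi> \<in> K" "K \<subseteq> {a..b}"
    using tagged_division_ofD(2,3)[OF assms] by auto
  with K show "Inf K \<in> K" "Sup K \<in> K" "Inf K \<le> \<xi>" "\<xi> \<le> Sup K" "a \<le> Inf K" "Sup K \<le> b"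
    by auto
qed

text \<open>Cousin's lemma for the constant gauge of radius \<open>\<delta>/2\<close>. It keeps the
  mesh condition from being vacuous: without arbitrarily fine divisions every vector would be an
  integral.\<close>

lemma tagged_division_mesh_below_exists:
  fixes a b :: real
  assumes "\<delta> > 0"
  obtains p where "p tagged_division_of {a..b}" "mesh_below \<delta> p"
proof -
  have "gauge (\<lambda>x::real. ball x (\<delta>/2))"
    using assms by (intro gauge_ball) auto
  then obtain p where p: "p tagged_division_of {a..b}" "(\<lambda>x. ball x (\<delta>/2)) fine p"
    using fine_division_exists_real by blast
  have "Sup K - Inf K < \<delta>" if "(\<xi>, K) \<in> p" for \<xi> K
  proof -
    note i = tagged_division_interval[OF p(1) that]
    have "K \<subseteq> ball \<xi> (\<delta>/2)" using p(2) that by (auto simp: fine_def)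
    then have "dist \<xi> (Inf K) < \<delta>/2" "dist \<xi> (Sup K) < \<delta>/2"
      using i(1,2) by (auto simp: subset_iff)
    then show ?thesis unfolding dist_real_def by linarith
  qed
  then have "mesh_below \<delta> p" by (auto simp: mesh_below_def)
  with p that show thesis by blast
qed

lemma has_RS_integralE:
  assumes "has_RS_integral a b M f I" "\<epsilon> > 0"
  obtains \<delta> where "\<delta> > 0"
    "\<forall>p. p tagged_division_of {a..b} \<longrightarrow> mesh_below \<delta> p \<longrightarrow> norm (RS_sum M f p - I) < \<epsilon>"
  using assms that unfolding has_RS_integral_alt by (auto simp: imp_conjL)

lemma has_RS_integral_approx:
  assumes "has_RS_integral a b M f I" "\<epsilon> > 0" "\<delta> > 0"
  obtains p where "p tagged_division_of {a..b}" "mesh_below \<delta> p" "norm (RS_sum M f p - I) < \<epsilon>"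
proof -
  obtain \<delta>' where d: "\<delta>' > 0"
    "\<forall>p. p tagged_division_of {a..b} \<longrightarrow> mesh_below \<delta>' p \<longrightarrow> norm (RS_sum M f p - I) < \<epsilon>"
    by (rule has_RS_integralE[OF assms(1,2)])
  have "min \<delta> \<delta>' > 0" using d(1) assms(3) by simp
  then obtain p where p: "p tagged_division_of {a..b}" "mesh_below (min \<delta> \<delta>') p"
    by (rule tagged_division_mesh_below_exists)
  show thesis
    by (rule that[OF p(1) mesh_below_mono[OF p(2)] d(2)[rule_format, OF p(1) mesh_below_mono[OF p(2)]]]) simp_all
qed

lemma has_RS_integral_diff:
  assumes "has_RS_integral a b M f I" "has_RS_integral a b M g J"
  shows "has_RS_integral a b M (\<lambda>\<theta>. f \<theta> - g \<theta>) (I - J)"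
  unfolding has_RS_integral_alt
proof (intro allI impI)
  fix \<epsilon> :: real assume "\<epsilon> > 0"
  then have e: "\<epsilon>/2 > 0" by simp
  obtain d1 where d1: "d1 > 0" "\<forall>p. p tagged_division_of {a..b} \<longrightarrow> mesh_below d1 p \<longrightarrow> norm (RS_sum M f p - I) < \<epsilon>/2"
    by (rule has_RS_integralE[OF assms(1) e])
  obtain d2 where d2: "d2 > 0" "\<forall>p. p tagged_division_of {a..b} \<longrightarrow> mesh_below d2 p \<longrightarrow> norm (RS_sum M g p - J) < \<epsilon>/2"
    by (rule has_RS_integralE[OF assms(2) e])
  show "\<exists>\<delta>>0. \<forall>p. p tagged_division_of {a..b} \<and> mesh_below \<delta> p \<longrightarrow>
      norm (RS_sum M (\<lambda>\<theta>. f \<theta> - g \<theta>) p - (I - J)) < \<epsilon>"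
  proof (intro exI[of _ "min d1 d2"] conjI allI impI)
    fix p assume p: "p tagged_division_of {a..b} \<and> mesh_below (min d1 d2) p"
    then have "norm (RS_sum M f p - I) < \<epsilon>/2" "norm (RS_sum M g p - J) < \<epsilon>/2"
      using d1(2)[rule_format, of p] d2(2)[rule_format, of p] mesh_below_mono[of "min d1 d2" p] by auto
    moreover have "RS_sum M (\<lambda>\<theta>. f \<theta> - g \<theta>) p = RS_sum M f p - RS_sum M g p"
      by (simp add: RS_sum_def matrix_vector_mult_diff_distrib sum_subtractf split_def)
    then have "norm (RS_sum M (\<lambda>\<theta>. f \<theta> - g \<theta>) p - (I - J)) = norm ((RS_sum M f p - I) - (RS_sum M g p - J))"
      by (simp only:) (simp add: algebra_simps)
    ultimately show "norm (RS_sum M (\<lambda>\<theta>. f \<theta> - g \<theta>) p - (I - J)) < \<epsilon>"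
      using norm_triangle_ineq4[of "RS_sum M f p - I" "RS_sum M g p - J"] by linarith
  qed (use d1 d2 in auto)
qed

lemma has_RS_integral_add_integrator:
  assumes "has_RS_integral a b M f I" "has_RS_integral a b N f J"
  shows "has_RS_integral a b (\<lambda>\<theta>. M \<theta> + N \<theta>) f (I + J)"
  unfolding has_RS_integral_alt
proof (intro allI impI)
  fix \<epsilon> :: real assume "\<epsilon> > 0"
  then have e: "\<epsilon>/2 > 0" by simp
  obtain d1 where d1: "d1 > 0" "\<forall>p. p tagged_division_of {a..b} \<longrightarrow> mesh_below d1 p \<longrightarrow> norm (RS_sum M f p - I) < \<epsilon>/2"
    by (rule has_RS_integralE[OF assms(1) e])
  obtain d2 where d2: "d2 > 0" "\<forall>p. p tagged_division_of {a..b} \<longrightarrow> mesh_below d2 p \<longrightarrow> norm (RS_sum N f p - J) < \<epsilon>/2"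
    by (rule has_RS_integralE[OF assms(2) e])
  show "\<exists>\<delta>>0. \<forall>p. p tagged_division_of {a..b} \<and> mesh_below \<delta> p \<longrightarrow>
      norm (RS_sum (\<lambda>\<theta>. M \<theta> + N \<theta>) f p - (I + J)) < \<epsilon>"
  proof (intro exI[of _ "min d1 d2"] conjI allI impI)
    fix p assume p: "p tagged_division_of {a..b} \<and> mesh_below (min d1 d2) p"
    then have "norm (RS_sum M f p - I) < \<epsilon>/2" "norm (RS_sum N f p - J) < \<epsilon>/2"
      using d1(2)[rule_format, of p] d2(2)[rule_format, of p] mesh_below_mono[of "min d1 d2" p] by auto
    moreover have "RS_sum (\<lambda>\<theta>. M \<theta> + N \<theta>) f p = RS_sum M f p + RS_sum N f p"
      unfolding RS_sum_def sum.distrib[symmetric]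
      by (intro sum.cong refl)
        (auto simp: matrix_vector_mult_add_rdistrib matrix_vector_mult_diff_rdistrib)
    then have "norm (RS_sum (\<lambda>\<theta>. M \<theta> + N \<theta>) f p - (I + J)) = norm ((RS_sum M f p - I) + (RS_sum N f p - J))"
      by (simp add: algebra_simps)
    ultimately show "norm (RS_sum (\<lambda>\<theta>. M \<theta> + N \<theta>) f p - (I + J)) < \<epsilon>"
      using norm_triangle_ineq[of "RS_sum M f p - I" "RS_sum N f p - J"] by linarith
  qed (use d1 d2 in auto)
qed

section \<open>Common refinements; existence and uniqueness of the integral\<close>

definition clip :: "real set \<Rightarrow> real \<Rightarrow> real" where
  "clip K t = max (Inf K) (min (Sup K) t)"

text \<open>
  Both sides are the increment of \<open>g\<close> over \<open>K \<inter> J\<close>. Written with \<^const>\<open>clip\<close>, the sum of the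
  increments over the common refinement of two divisions telescopes in either variable.
\<close>

lemma clip_increment_commute:
  fixes g :: "real \<Rightarrow> 'a::ab_group_add"
  assumes "Inf K \<le> Sup K" "Inf J \<le> Sup J"
  shows "g (clip K (Sup J)) - g (clip K (Inf J)) = g (clip J (Sup K)) - g (clip J (Inf K))"
proof (cases "Inf J \<le> Sup K \<and> Inf K \<le> Sup J")
  case True
  then have "clip K (Sup J) = clip J (Sup K)" "clip K (Inf J) = clip J (Inf K)"
    using assms unfolding clip_def by linarith+
  then show ?thesis by simp
next
  case False
  then have "clip K (Sup J) = clip K (Inf J)" "clip J (Sup K) = clip J (Inf K)"
    using assms unfolding clip_def by linarith+
  then show ?thesis by simp
qed

lemma clip_endpoints:
  assumes "a \<le> Inf K" "Inf K \<le> Sup K" "Sup K \<le> b"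
  shows "clip K a = Inf K" "clip K b = Sup K"
  using assms by (auto simp: clip_def)

lemma clip_bounds:
  assumes "a \<le> Inf K" "Inf K \<le> Sup K" "Sup K \<le> b"
  shows "a \<le> clip K t" "clip K t \<le> b"
  using assms unfolding clip_def by linarith+

lemma clip_mono: "s \<le> t \<Longrightarrow> clip K s \<le> clip K t"
  by (auto simp: clip_def)

text \<open>As \<open>t\<close> goes from \<open>a\<close> to \<open>b\<close>,
  \<open>clip K t\<close> goes from \<open>Inf K\<close> to \<open>Sup K\<close>. Hence the
  increments of \<open>M\<close> composed with \<open>clip K\<close> along \<open>q\<close>
  telescope to the increment of \<open>M\<close> over \<open>K\<close>.\<close>

lemma RS_sum_refine:
  assumes "a \<le> b" "p tagged_division_of {a..b}" "q tagged_division_of {a..b}"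
  shows "RS_sum M f p = (\<Sum>(\<xi>, K)\<in>p. \<Sum>(\<eta>, J)\<in>q. (M (clip K (Sup J)) - M (clip K (Inf J))) *v f \<xi>)"
  unfolding RS_sum_def
proof (intro sum.cong refl, clarify)
  fix \<xi> K assume "(\<xi>, K) \<in> p"
  note i = tagged_division_interval(3-6)[OF assms(2) this]
  have c: "clip K a = Inf K" "clip K b = Sup K"
    using clip_endpoints[of a K b] i by auto
  have "(\<Sum>(\<eta>, J)\<in>q. M (clip K (Sup J)) *v f \<xi> - M (clip K (Inf J)) *v f \<xi>)
      = M (Sup K) *v f \<xi> - M (Inf K) *v f \<xi>"
    using additive_tagged_division_1[OF assms(1,3), of "\<lambda>t. M (clip K t) *v f \<xi>"] c by simp
  then show "(M (Sup K) - M (Inf K)) *v f \<xi> =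
      (\<Sum>(\<eta>, J)\<in>q. (M (clip K (Sup J)) - M (clip K (Inf J))) *v f \<xi>)"
    by (simp add: matrix_vector_mult_diff_rdistrib)
qed

text \<open>Both sums are written over the pairs \<open>(K, J)\<close>, that is, over the common
  refinement, so that they differ only in the tags. The dominating weights \<open>?d K J\<close> are
  nonnegative and add up to \<open>v b - v a\<close>.\<close>

lemma RS_sum_diff_le:
  assumes ab: "a \<le> b" and p: "p tagged_division_of {a..b}" "mesh_below \<delta> p"
    and q: "q tagged_division_of {a..b}" "mesh_below \<delta> q"
    and dom: "dominated_on a b M v"
    and f: "\<And>s t. s \<in> {a..b} \<Longrightarrow> t \<in> {a..b} \<Longrightarrow> \<bar>s - t\<bar> < 2 * \<delta> \<Longrightarrow> norm (f s - f t) \<le> \<epsilon>"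
  shows "norm (RS_sum M f p - RS_sum M f q) \<le> \<epsilon> * (v b - v a)"
proof -
  let ?D = "\<lambda>K J. M (clip K (Sup J)) - M (clip K (Inf J))"
  let ?d = "\<lambda>K J. v (clip K (Sup J)) - v (clip K (Inf J))"
  have "RS_sum M f q = (\<Sum>(\<eta>, J)\<in>q. \<Sum>(\<xi>, K)\<in>p. ?D J K *v f \<eta>)"
    using RS_sum_refine[OF ab q(1) p(1)] .
  also have "\<dots> = (\<Sum>(\<eta>, J)\<in>q. \<Sum>(\<xi>, K)\<in>p. ?D K J *v f \<eta>)"
  proof (intro sum.cong refl, clarify, intro sum.cong refl, clarify)
    fix \<eta> J \<xi> K assume "(\<eta>, J) \<in> q" "(\<xi>, K) \<in> p"
    then have "Inf J \<le> Sup J" "Inf K \<le> Sup K"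
      using tagged_division_interval(3,4)[OF q(1)] tagged_division_interval(3,4)[OF p(1)]
      by (blast intro: order_trans)+
    then show "?D J K *v f \<eta> = ?D K J *v f \<eta>"
      using clip_increment_commute[of J K M] by simp
  qed
  also have "\<dots> = (\<Sum>(\<xi>, K)\<in>p. \<Sum>(\<eta>, J)\<in>q. ?D K J *v f \<eta>)"
    unfolding split_def by (rule sum.swap)
  finally have "RS_sum M f p - RS_sum M f q = (\<Sum>(\<xi>, K)\<in>p. \<Sum>(\<eta>, J)\<in>q. ?D K J *v (f \<xi> - f \<eta>))"
    by (simp add: RS_sum_refine[OF ab p(1) q(1)] matrix_vector_mult_diff_distrib sum_subtractf split_def)
  also have "norm \<dots> \<le> (\<Sum>(\<xi>, K)\<in>p. \<Sum>(\<eta>, J)\<in>q. \<epsilon> * ?d K J)"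
  proof (intro sum_norm_le, clarify, intro sum_norm_le, clarify)
    fix \<xi> K \<eta> J assume K: "(\<xi>, K) \<in> p" and J: "(\<eta>, J) \<in> q"
    note i = tagged_division_interval(3-6)[OF p(1) K] and j = tagged_division_interval(3-6)[OF q(1) J]
    have c: "a \<le> clip K (Inf J)" "clip K (Inf J) \<le> clip K (Sup J)" "clip K (Sup J) \<le> b"
      using i j by (simp_all add: clip_bounds clip_mono)
    have D: "norm (?D K J *v (f \<xi> - f \<eta>)) \<le> ?d K J * norm (f \<xi> - f \<eta>)"
      by (rule dominated_onD[OF dom c])
    show "norm (?D K J *v (f \<xi> - f \<eta>)) \<le> \<epsilon> * ?d K J"
    \<comment> \<open>If \<open>K\<close> and \<open>J\<close> meet, their tags are less than
      \<open>2 * \<delta>\<close> apart, since each interval is shorter than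
      \<open>\<delta>\<close>. Otherwise \<open>clip K\<close> is constant on \<open>J\<close> and
      the term vanishes.\<close>
    proof (cases "Inf J \<le> Sup K \<and> Inf K \<le> Sup J")
      case True
      have "\<bar>\<xi> - \<eta>\<bar> < 2 * \<delta>"
        using True i j mesh_belowD[OF p(2) K] mesh_belowD[OF q(2) J] by linarith
      then have "norm (f \<xi> - f \<eta>) \<le> \<epsilon>" using i j by (intro f) auto
      moreover have "0 \<le> ?d K J"
        using dominated_on_mono[OF dom c] by simp
      ultimately have "?d K J * norm (f \<xi> - f \<eta>) \<le> ?d K J * \<epsilon>" by (rule mult_left_mono)
      with D show ?thesis by (simp add: mult.commute)
    next
      case False
      then have "clip K (Sup J) = clip K (Inf J)"
        using i j unfolding clip_def by linarith
      then show ?thesis by simp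
    qed
  qed
  also have "\<dots> = (\<Sum>(\<xi>, K)\<in>p. \<epsilon> * (v (Sup K) - v (Inf K)))"
  proof (intro sum.cong refl, clarify)
    fix \<xi> K assume "(\<xi>, K) \<in> p"
    note i = tagged_division_interval(3-6)[OF p(1) this]
    have c: "clip K a = Inf K" "clip K b = Sup K"
      using clip_endpoints[of a K b] i by auto
    show "(\<Sum>(\<eta>, J)\<in>q. \<epsilon> * ?d K J) = \<epsilon> * (v (Sup K) - v (Inf K))"
      using additive_tagged_division_1[OF ab q(1), of "\<lambda>t. v (clip K t)"] c
      by (simp add: sum_distrib_left[symmetric] split_def)
  qed
  also have "\<dots> = \<epsilon> * (v b - v a)"
    using additive_tagged_division_1[OF ab p(1), of v]
    by (simp add: sum_distrib_left[symmetric] split_def)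
  finally show ?thesis .
qed

text \<open>Uniform continuity of \<open>f\<close> makes the sums Cauchy as the mesh tends to 0. The
  limit is taken along one sequence \<open>P\<close> of divisions, and any other fine division is
  then compared with a late member of it.\<close>

lemma has_RS_integral_exists:
  assumes ab: "a \<le> b" and dom: "dominated_on a b M v" and f: "continuous_on {a..b} f"
  shows "\<exists>I. has_RS_integral a b M f I"
proof -
  have V: "0 \<le> v b - v a" using dominated_on_mono[OF dom] ab by simp
  have fine: "\<exists>\<delta>>0. \<forall>p q. p tagged_division_of {a..b} \<and> mesh_below \<delta> p \<and>
      q tagged_division_of {a..b} \<and> mesh_below \<delta> q \<longrightarrow> norm (RS_sum M f p - RS_sum M f q) < \<epsilon>"
    if "\<epsilon> > 0" for \<epsilon> :: real
  proof -
    \<comment> \<open>The added 1 covers the case \<open>v a = v b\<close> and makes the final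
      estimate strict.\<close>
    define e where "e = \<epsilon> / (v b - v a + 1)"
    have e: "e > 0" using that V by (simp add: e_def)
    have "uniformly_continuous_on {a..b} f"
      using f by (intro compact_uniformly_continuous) auto
    then obtain d where d: "d > 0" "\<And>s t. s \<in> {a..b} \<Longrightarrow> t \<in> {a..b} \<Longrightarrow> dist t s < d \<Longrightarrow> dist (f t) (f s) < e"
      using e unfolding uniformly_continuous_on_def by blast
    \<comment> \<open>The mesh is half of \<open>d\<close> because \<open>RS_sum_diff_le\<close>
      compares tags up to twice the mesh apart.\<close>
    have "norm (RS_sum M f p - RS_sum M f q) < \<epsilon>"
      if "p tagged_division_of {a..b}" "mesh_below (d/2) p"
        "q tagged_division_of {a..b}" "mesh_below (d/2) q" for p q
    proof -
      have "norm (RS_sum M f p - RS_sum M f q) \<le> e * (v b - v a)"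
      proof (rule RS_sum_diff_le[OF ab that dom])
        fix s t assume "s \<in> {a..b}" "t \<in> {a..b}" "\<bar>s - t\<bar> < 2 * (d/2)"
        then show "norm (f s - f t) \<le> e"
          using d(2)[of t s] by (simp add: dist_norm)
      qed
      also have "\<dots> < e * (v b - v a + 1)" using e by simp
      also have "\<dots> = \<epsilon>" using V by (simp add: e_def)
      finally show ?thesis .
    qed
    then show ?thesis using d(1) by (intro exI[of _ "d/2"]) auto
  qed
  have "\<exists>p. p tagged_division_of {a..b} \<and> mesh_below (inverse (real (Suc n))) p" for n
    by (rule tagged_division_mesh_below_exists[of "inverse (real (Suc n))" a b]) auto
  then obtain P where P: "\<And>n. P n tagged_division_of {a..b}" "\<And>n. mesh_below (inverse (real (Suc n))) (P n)"
    by metis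
  have small: "\<exists>N. \<forall>n\<ge>N. mesh_below \<delta> (P n)" if d: "\<delta> > 0" for \<delta>
  proof -
    obtain N where N: "inverse (real (Suc N)) < \<delta>" using d reals_Archimedean by blast
    have "mesh_below \<delta> (P n)" if "n \<ge> N" for n
    proof (rule mesh_below_mono[OF P(2)])
      have "inverse (real (Suc n)) \<le> inverse (real (Suc N))"
        using that by (intro le_imp_inverse_le) auto
      with N show "inverse (real (Suc n)) \<le> \<delta>" by linarith
    qed
    then show ?thesis by blast
  qed
  have "Cauchy (\<lambda>n. RS_sum M f (P n))"
  proof (rule CauchyI)
    fix \<epsilon> :: real assume "\<epsilon> > 0"
    from fine[OF this] obtain \<delta> where \<delta>: "\<delta> > 0" "\<forall>p q. p tagged_division_of {a..b} \<and> mesh_below \<delta> p \<and>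
      q tagged_division_of {a..b} \<and> mesh_below \<delta> q \<longrightarrow> norm (RS_sum M f p - RS_sum M f q) < \<epsilon>"
      by blast
    from small[OF \<delta>(1)] obtain N where "\<forall>n\<ge>N. mesh_below \<delta> (P n)" by blast
    with \<delta>(2) P(1) show "\<exists>N. \<forall>m\<ge>N. \<forall>n\<ge>N. norm (RS_sum M f (P m) - RS_sum M f (P n)) < \<epsilon>"
      by (intro exI[of _ N]) simp
  qed
  then obtain I where I: "(\<lambda>n. RS_sum M f (P n)) \<longlonglongrightarrow> I"
    by (auto simp: Cauchy_convergent_iff convergent_def)
  have "has_RS_integral a b M f I"
    unfolding has_RS_integral_alt
  proof (intro allI impI)
    fix \<epsilon> :: real assume "\<epsilon> > 0"
    then have e: "\<epsilon>/2 > 0" by simp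
    from fine[OF e] obtain \<delta> where \<delta>: "\<delta> > 0" "\<forall>p q. p tagged_division_of {a..b} \<and> mesh_below \<delta> p \<and>
      q tagged_division_of {a..b} \<and> mesh_below \<delta> q \<longrightarrow> norm (RS_sum M f p - RS_sum M f q) < \<epsilon>/2"
      by blast
    obtain N where N: "\<forall>n\<ge>N. mesh_below \<delta> (P n)" using small \<delta>(1) by blast
    obtain N' where N': "\<forall>n\<ge>N'. norm (RS_sum M f (P n) - I) < \<epsilon>/2"
      using I e unfolding LIMSEQ_iff by blast
    define n where "n = max N N'"
    have n: "mesh_below \<delta> (P n)" "norm (RS_sum M f (P n) - I) < \<epsilon>/2"
      using N N' by (auto simp: n_def)
    show "\<exists>\<delta>>0. \<forall>p. p tagged_division_of {a..b} \<and> mesh_below \<delta> p \<longrightarrow> norm (RS_sum M f p - I) < \<epsilon>"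
    proof (intro exI[of _ \<delta>] conjI allI impI)
      fix p assume "p tagged_division_of {a..b} \<and> mesh_below \<delta> p"
      then have "norm (RS_sum M f p - RS_sum M f (P n)) < \<epsilon>/2"
        using \<delta>(2) P(1) n(1) by simp
      with n(2) show "norm (RS_sum M f p - I) < \<epsilon>"
        using norm_triangle_ineq[of "RS_sum M f p - RS_sum M f (P n)" "RS_sum M f (P n) - I"] by simp
    qed (use \<delta> in auto)
  qed
  then show ?thesis ..
qed

lemma has_RS_integral_unique:
  assumes "has_RS_integral a b M f I" "has_RS_integral a b M f J"
  shows "I = J"
proof (rule ccontr)
  assume "I \<noteq> J"
  have "has_RS_integral a b M (\<lambda>\<theta>. f \<theta> - f \<theta>) (I - J)"
    using has_RS_integral_diff[OF assms] .
  moreover have "norm (I - J) > 0" using \<open>I \<noteq> J\<close> by simp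
  ultimately obtain p where "norm (RS_sum M (\<lambda>\<theta>. f \<theta> - f \<theta>) p - (I - J)) < norm (I - J)"
    by (rule has_RS_integral_approx[where \<delta> = 1]) auto
  then show False by (simp add: RS_sum_def split_def norm_minus_commute)
qed

section \<open>Integrators of bounded variation\<close>

text \<open>The witness is the total variation on \<open>{a..t}\<close>. Appending
  \<open>{s..t}\<close> to a division of \<open>{a..s}\<close> shows that this variation grows from
  \<open>s\<close> to \<open>t\<close> by at least the norm of \<open>M t - M s\<close>.\<close>

lemma bounded_variation_dominated:
  fixes M :: "real \<Rightarrow> real^'n^'n"
  assumes bv: "bounded_variation_on a b M"
  obtains v where "dominated_on a b M v"
proof -
  define N where "N K = onorm (\<lambda>u. (M (Sup K) - M (Inf K)) *v u)" for K
  define S where "S t = {\<Sum>K\<in>P. N K | P. P division_of {a..t}}" for t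
  have N0: "0 \<le> N K" for K
    unfolding N_def by (intro onorm_pos_le matrix_vector_mul_bounded_linear)
  have extend: "x + N {s..t} \<in> S t" if st: "a \<le> s" "s < t" and x: "x \<in> S s" for s t x
  proof -
    obtain P where P: "P division_of {a..s}" "x = (\<Sum>K\<in>P. N K)"
      using x unfolding S_def by blast
    have "{{s..t}} division_of {s..t}"
      using division_of_self[of s t] st by simp
    moreover have "interior {a..s} \<inter> interior {s..t} = {}" by auto
    ultimately have "(P \<union> {{s..t}}) division_of ({a..s} \<union> {s..t})"
      by (intro division_disjoint_union P(1))
    moreover have "{a..s} \<union> {s..t} = {a..t}" using st by auto
    \<comment> \<open>A division is a set, so the union gains the term for \<open>{s..t}\<close>
      only if this interval is new.\<close>
    moreover have "{s..t} \<notin> P"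
    proof
      assume "{s..t} \<in> P"
      then have "{s..t} \<subseteq> {a..s}" using division_ofD(2)[OF P(1)] by blast
      then show False using st by auto
    qed
    then have "(\<Sum>K\<in>P \<union> {{s..t}}. N K) = x + N {s..t}"
      using P division_ofD(1)[OF P(1)] by simp
    ultimately show ?thesis unfolding S_def by (metis (mono_tags, lifting) mem_Collect_eq)
  qed
  have ne: "S t \<noteq> {}" if "a \<le> t" for t
    using division_of_self[of a t] that unfolding S_def by auto
  have bdd_b: "bdd_above (S b)"
    using bv unfolding bounded_variation_on_def S_def N_def .
  \<comment> \<open>Appending \<open>{t..b}\<close> adds a nonnegative term, so the bound at
    \<open>b\<close> also serves at \<open>t\<close>.\<close>
  have bdd: "bdd_above (S t)" if t: "a \<le> t" "t \<le> b" for t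
  proof (cases "t = b")
    case False
    obtain B where B: "\<And>x. x \<in> S b \<Longrightarrow> x \<le> B" using bdd_b unfolding bdd_above_def by blast
    have "x \<le> B" if "x \<in> S t" for x
      using B[OF extend[of t b x]] N0[of "{t..b}"] that t False by simp
    then show ?thesis unfolding bdd_above_def by blast
  qed (use bdd_b in simp)
  have "dominated_on a b M (\<lambda>t. Sup (S t))"
    unfolding dominated_on_def
  proof (intro allI impI)
    fix s t u assume st: "a \<le> s" "s \<le> t" "t \<le> b"
    show "norm ((M t - M s) *v u) \<le> (Sup (S t) - Sup (S s)) * norm u"
    proof (cases "s = t")
      case False
      have "Sup (S s) \<le> Sup (S t) - N {s..t}"
      proof (rule cSup_least[OF ne[OF st(1)]])
        fix x assume "x \<in> S s"
        then have "x + N {s..t} \<in> S t" using st False by (intro extend) auto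
        then have "x + N {s..t} \<le> Sup (S t)" using bdd st by (intro cSup_upper) auto
        then show "x \<le> Sup (S t) - N {s..t}" by simp
      qed
      moreover have "norm ((M t - M s) *v u) \<le> N {s..t} * norm u"
        using onorm[OF matrix_vector_mul_bounded_linear, of "M t - M s" u] st by (simp add: N_def)
      ultimately show ?thesis
        by (smt (verit) mult_right_mono norm_ge_zero)
    qed simp
  qed
  then show thesis by (rule that)
qed

section \<open>Left limits and splitting off the jump at the right endpoint\<close>

lemma mono_left_limit:
  fixes v :: "real \<Rightarrow> real"
  assumes "a < b" "\<And>s t. a \<le> s \<Longrightarrow> s \<le> t \<Longrightarrow> t \<le> b \<Longrightarrow> v s \<le> v t"
  obtains l where "(v \<longlongrightarrow> l) (at_left b)"
proof -
  have "(v \<longlongrightarrow> Sup (v ` ({..<b} \<inter> {a<..}))) (at b within ({..<b} \<inter> {a<..}))"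
    by (rule Lim_left_bound[where K = "v b"]) (auto intro!: assms(2))
  moreover have "at b within ({..<b} \<inter> {a<..}) = at_left b"
    by (rule at_within_nhd[of b "{a<..}"]) (use assms(1) in auto)
  ultimately show thesis using that by simp
qed

lemma bounded_linear_matrix_vector_mult_left:
  "bounded_linear (\<lambda>A. (A :: real^'n^'m) *v u)"
proof -
  have "linear (\<lambda>A. (A :: real^'n^'m) *v u)"
    by (rule linearI) (simp_all add: matrix_vector_mult_add_rdistrib scaleR_matrix_vector_assoc)
  then show ?thesis by (simp add: linear_conv_bounded_linear)
qed

text \<open>Jordan decomposition, entry by entry: an entry of \<open>M\<close> changes by no more
  than \<open>v\<close> does, so \<open>v\<close> plus the entry is nondecreasing and has a left
  limit. Subtracting the limit of \<open>v\<close> gives that of the entry.\<close>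

lemma dominated_on_left_limit:
  fixes M :: "real \<Rightarrow> real^'n^'n"
  assumes "a < b" and dom: "dominated_on a b M v"
  obtains A where "(M \<longlongrightarrow> A) (at_left b)"
proof -
  obtain l where l: "(v \<longlongrightarrow> l) (at_left b)"
    by (rule mono_left_limit[OF assms(1), of v]) (rule dominated_on_mono[OF dom])
  have "\<exists>c. ((\<lambda>t. M t $ i $ j) \<longlongrightarrow> c) (at_left b)" for i j
  proof -
    have "v s + M s $ i $ j \<le> v t + M t $ i $ j" if "a \<le> s" "s \<le> t" "t \<le> b" for s t
    proof -
      have "norm ((M t - M s) *v axis j 1) \<le> v t - v s"
        using dominated_onD[OF dom that, of "axis j 1"] by (simp add: norm_axis_1)
      moreover have "\<bar>((M t - M s) *v axis j 1) $ i\<bar> \<le> norm ((M t - M s) *v axis j 1)"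
        by (rule component_le_norm_cart)
      moreover have "((M t - M s) *v axis j 1) $ i = M t $ i $ j - M s $ i $ j"
        by (simp add: matrix_vector_mult_basis column_def)
      ultimately show ?thesis by linarith
    qed
    then obtain c where "((\<lambda>t. v t + M t $ i $ j) \<longlongrightarrow> c) (at_left b)"
      using mono_left_limit[OF assms(1), of "\<lambda>t. v t + M t $ i $ j"] by blast
    from tendsto_diff[OF this l] show ?thesis by auto
  qed
  then obtain A where "\<And>i j. ((\<lambda>t. M t $ i $ j) \<longlongrightarrow> A i j) (at_left b)" by metis
  then have "(M \<longlongrightarrow> (\<chi> i j. A i j)) (at_left b)"
    by (intro vec_tendstoI) simp
  then show thesis by (rule that)
qed

text \<open>The estimate passes to the limit as \<open>t\<close> tends to \<open>b\<close> from the
  left. Changing \<open>v\<close> along with \<open>M\<close> gives a dominating function without a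
  jump at \<open>b\<close>, as the exponential estimate below requires.\<close>

lemma dominated_on_update_right:
  fixes M :: "real \<Rightarrow> real^'n^'n"
  assumes dom: "dominated_on a b M v"
    and A: "(M \<longlongrightarrow> A) (at_left b)" and l: "(v \<longlongrightarrow> l) (at_left b)"
  shows "dominated_on a b (M(b := A)) (v(b := l))"
  unfolding dominated_on_def
proof (intro allI impI)
  fix s t u assume st: "a \<le> s" "s \<le> t" "t \<le> b"
  show "norm (((M(b := A)) t - (M(b := A)) s) *v u) \<le> ((v(b := l)) t - (v(b := l)) s) * norm u"
  proof (cases "t = b \<and> s < b")
    case True
    have "norm ((A - M s) *v u) \<le> (l - v s) * norm u"
    proof (rule tendsto_le[OF trivial_limit_at_left_real])
      show "((\<lambda>t. norm ((M t - M s) *v u)) \<longlongrightarrow> norm ((A - M s) *v u)) (at_left b)"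
        by (intro tendsto_norm bounded_linear.tendsto[OF bounded_linear_matrix_vector_mult_left]
            tendsto_diff A tendsto_const)
      show "((\<lambda>t. (v t - v s) * norm u) \<longlongrightarrow> (l - v s) * norm u) (at_left b)"
        by (intro tendsto_intros l)
      have "\<forall>\<^sub>F t in at_left b. t \<in> {s<..<b}"
        using True by (intro eventually_at_left_real) auto
      then show "\<forall>\<^sub>F t in at_left b. norm ((M t - M s) *v u) \<le> (v t - v s) * norm u"
        by eventually_elim (use st in \<open>auto intro!: dominated_onD[OF dom]\<close>)
    qed
    then show ?thesis using True by simp
  next
    case False
    then show ?thesis using st dominated_onD[OF dom st] by auto
  qed
qed

text \<open>Only a nondegenerate interval ending at \<open>b\<close> contributes to the sums, and
  its tag is within the mesh of \<open>b\<close>, where \<open>f\<close> is close to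
  \<open>f b\<close>.\<close>

lemma has_RS_integral_right_jump:
  fixes A :: "real^'n^'n"
  assumes ab: "a < b" and f: "continuous_on {a..b} f"
  shows "has_RS_integral a b (\<lambda>t. if t = b then A else 0) f (A *v f b)"
  unfolding has_RS_integral_alt
proof (intro allI impI)
  fix \<epsilon> :: real assume "\<epsilon> > 0"
  let ?N = "\<lambda>t. if t = b then A else 0" and ?c = "\<lambda>t. if t = b then 1 else (0::real)"
  obtain C where C: "C > 0" "\<And>u. norm (A *v u) \<le> norm u * C"
    using bounded_linear.pos_bounded[OF matrix_vector_mul_bounded_linear[of A]] by blast
  define e where "e = \<epsilon> / (2 * C)"
  have "e > 0" using \<open>\<epsilon> > 0\<close> C by (simp add: e_def)
  then obtain d where d: "d > 0" "\<And>s. s \<in> {a..b} \<Longrightarrow> dist s b < d \<Longrightarrow> dist (f s) (f b) < e"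
    using f ab unfolding continuous_on_iff by (metis atLeastAtMost_iff less_imp_le order_refl)
  show "\<exists>\<delta>>0. \<forall>p. p tagged_division_of {a..b} \<and> mesh_below \<delta> p \<longrightarrow>
      norm (RS_sum ?N f p - A *v f b) < \<epsilon>"
  proof (intro exI[of _ d] conjI allI impI d(1))
    fix p assume "p tagged_division_of {a..b} \<and> mesh_below d p"
    then have p: "p tagged_division_of {a..b}" "mesh_below d p" by auto
    have "(\<Sum>(\<xi>, K)\<in>p. ?N (Sup K) *v f b - ?N (Inf K) *v f b) = A *v f b"
      using additive_tagged_division_1[of a b p "\<lambda>t. ?N t *v f b"] p ab by simp
    then have "RS_sum ?N f p - A *v f b = (\<Sum>(\<xi>, K)\<in>p. (?N (Sup K) - ?N (Inf K)) *v (f \<xi> - f b))"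
      by (simp add: RS_sum_def split_def sum_subtractf matrix_vector_mult_diff_distrib
          matrix_vector_mult_diff_rdistrib)
    \<comment> \<open>\<open>?c\<close> is a scalar copy of \<open>?N\<close>. Its increments
      telescope to 1, so the last interval need not be singled out.\<close>
    also have "norm \<dots> \<le> (\<Sum>(\<xi>, K)\<in>p. (e * C) * (?c (Sup K) - ?c (Inf K)))"
    proof (rule sum_norm_le, clarify)
      fix \<xi> K assume K: "(\<xi>, K) \<in> p"
      note i = tagged_division_interval(3-6)[OF p(1) K]
      show "norm ((?N (Sup K) - ?N (Inf K)) *v (f \<xi> - f b)) \<le> (e * C) * (?c (Sup K) - ?c (Inf K))"
      proof (cases "Sup K = b \<and> Inf K \<noteq> b")
        case True
        have "dist \<xi> b < d"
          using mesh_belowD[OF p(2) K] i True unfolding dist_real_def by linarith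
        then have "norm (f \<xi> - f b) < e"
          using d(2)[of \<xi>] i by (simp add: dist_norm)
        then have "norm (f \<xi> - f b) * C \<le> e * C"
          using C(1) by (intro mult_right_mono) auto
        then have "norm (A *v (f \<xi> - f b)) \<le> e * C"
          using C(2)[of "f \<xi> - f b"] by linarith
        then show ?thesis using True by simp
      next
        case False
        then have "(Sup K = b) = (Inf K = b)" using i by auto
        then show ?thesis by simp
      qed
    qed
    also have "\<dots> = e * C"
      using additive_tagged_division_1[of a b p ?c] p ab
      by (simp add: sum_distrib_left[symmetric] split_def)
    also have "\<dots> < \<epsilon>" using \<open>\<epsilon> > 0\<close> C by (simp add: e_def)
    finally show "norm (RS_sum ?N f p - A *v f b) < \<epsilon>" .
  qed
qed

text \<open>
  Since \<open>v\<close> has no jump at \<open>0\<close>, the variation of \<open>M\<close> near \<open>0\<close> is small, and away from \<open>0\<close> the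
  exponential weight is small.
\<close>

lemma has_RS_integral_exp_weight:
  fixes M :: "real \<Rightarrow> real^'n^'n"
  assumes a: "a < 0" and dom: "dominated_on a 0 M v" and lim: "(v \<longlongrightarrow> v 0) (at_left 0)"
    and \<kappa>: "\<kappa> > 0"
  obtains l where "l > 0"
    "\<forall>f I m. has_RS_integral a 0 M f I \<longrightarrow> (\<forall>\<theta>\<in>{a..0}. norm (f \<theta>) \<le> m * exp (l * \<theta>)) \<longrightarrow>
       norm I \<le> \<kappa> * m"
proof -
  have "\<forall>\<^sub>F t in at_left 0. v t > v 0 - \<kappa>/2"
    using order_tendstoD(1)[OF lim, of "v 0 - \<kappa>/2"] \<kappa> by simp
  moreover have "\<forall>\<^sub>F t in at_left 0. t \<in> {a<..<0}"
    using a by (rule eventually_at_left_real)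
  ultimately have "\<forall>\<^sub>F t in at_left 0. v t > v 0 - \<kappa>/2 \<and> t \<in> {a<..<0}"
    by (rule eventually_conj)
  from eventually_happens'[OF trivial_limit_at_left_real this]
  obtain c where c: "v c > v 0 - \<kappa>/2" "a < c" "c < 0"
    by auto
  define V where "V = v 0 - v a"
  have V: "V \<ge> 0" using dominated_on_mono[OF dom] a by (simp add: V_def)
  \<comment> \<open>Since \<open>exp X \<ge> 1 + X\<close>, this choice gives
    \<open>exp (- X) * V \<le> \<kappa>/2\<close>; the added 1 keeps \<open>X\<close> positive when
    \<open>V = 0\<close>. Then \<open>l\<close> is chosen so that the weight at \<open>c/2\<close>
    equals \<open>exp (- X)\<close>.\<close>
  define X where "X = 2 * V / \<kappa> + 1"
  define l where "l = 2 * X / (- c)"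
  have X: "X > 0" using V \<kappa> by (simp add: X_def add_nonneg_pos)
  have l: "l > 0" using X c by (simp add: l_def divide_pos_neg)
  have lc: "l * (c/2) = - X" using c by (simp add: l_def field_simps)
  have "2 * V / \<kappa> \<le> exp X" using exp_ge_add_one_self[of X] by (simp add: X_def)
  then have far: "exp (- X) * V \<le> \<kappa>/2"
    using \<kappa> by (simp add: exp_minus field_simps)
  show thesis
  proof (rule that[OF l], intro allI impI)
    fix f I m
    assume I: "has_RS_integral a 0 M f I"
      and "\<forall>\<theta>\<in>{a..0}. norm (f \<theta>) \<le> m * exp (l * \<theta>)"
    then have f: "norm (f \<theta>) \<le> m * exp (l * \<theta>)" if "\<theta> \<in> {a..0}" for \<theta>
      using that by blast
    have m: "m \<ge> 0" using order_trans[OF norm_ge_zero f[of 0]] a by simp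
    \<comment> \<open>\<open>w\<close> records only the variation on \<open>{c..0}\<close>, whose
      total is below \<open>\<kappa>/2\<close>. Each term is bounded by a near part in
      \<open>w\<close> plus a far part in \<open>v\<close> damped by \<open>exp (- X)\<close>, and
      both telescope.\<close>
    define w where "w t = v (max c t)" for t
    show "norm I \<le> \<kappa> * m"
    proof (rule field_le_epsilon)
      fix \<epsilon> :: real assume "\<epsilon> > 0"
      \<comment> \<open>With this mesh, an interval starting left of \<open>c\<close> ends left of
        \<open>c/2\<close>, so the weight at its tag is at most \<open>exp (- X)\<close>.\<close>
      moreover have "- c/2 > 0" using c by simp
      ultimately obtain p where p: "p tagged_division_of {a..0}" "mesh_below (- c/2) p"
          "norm (RS_sum M f p - I) < \<epsilon>"
        by (rule has_RS_integral_approx[OF I])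
      have "norm (RS_sum M f p) \<le> (\<Sum>(\<xi>, K)\<in>p. m * ((w (Sup K) - w (Inf K)) + exp (- X) * (v (Sup K) - v (Inf K))))"
        unfolding RS_sum_def
      proof (rule sum_norm_le, clarify)
        fix \<xi> K assume K: "(\<xi>, K) \<in> p"
        note i = tagged_division_interval(3-6)[OF p(1) K]
        have dv: "0 \<le> v (Sup K) - v (Inf K)"
          using i dominated_on_mono[OF dom, of "Inf K" "Sup K"] by simp
        have dw: "0 \<le> w (Sup K) - w (Inf K)"
          using i c dominated_on_mono[OF dom, of "max c (Inf K)" "max c (Sup K)"] by (simp add: w_def)
        have "norm ((M (Sup K) - M (Inf K)) *v f \<xi>) \<le> (v (Sup K) - v (Inf K)) * norm (f \<xi>)"
          using i by (intro dominated_onD[OF dom]) auto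
        also have "\<dots> \<le> (v (Sup K) - v (Inf K)) * (m * exp (l * \<xi>))"
          using i dv by (intro mult_left_mono f) auto
        also have "\<dots> = m * ((v (Sup K) - v (Inf K)) * exp (l * \<xi>))" by simp
        also have "\<dots> \<le> m * ((w (Sup K) - w (Inf K)) + exp (- X) * (v (Sup K) - v (Inf K)))"
        proof (rule mult_left_mono[OF _ m])
          show "(v (Sup K) - v (Inf K)) * exp (l * \<xi>)
              \<le> (w (Sup K) - w (Inf K)) + exp (- X) * (v (Sup K) - v (Inf K))"
          proof (cases "c \<le> Inf K")
            case True
            then have "w (Sup K) - w (Inf K) = v (Sup K) - v (Inf K)"
              using i by (simp add: w_def max_def)
            moreover have "exp (l * \<xi>) \<le> 1" using l i by (simp add: mult_nonneg_nonpos)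
            then have "(v (Sup K) - v (Inf K)) * exp (l * \<xi>) \<le> v (Sup K) - v (Inf K)"
              using dv by (intro mult_left_le)
            moreover have "0 \<le> exp (- X) * (v (Sup K) - v (Inf K))" using dv by simp
            ultimately show ?thesis by linarith
          next
            case False
            then have "\<xi> \<le> c/2" using i mesh_belowD[OF p(2) K] by linarith
            then have "l * \<xi> \<le> - X" using l mult_left_mono[of \<xi> "c/2" l] unfolding lc by simp
            then have "exp (l * \<xi>) * (v (Sup K) - v (Inf K)) \<le> exp (- X) * (v (Sup K) - v (Inf K))"
              using dv by (intro mult_right_mono) auto
            then show ?thesis using dw by (simp add: mult.commute)
          qed
        qed
        finally show "norm ((M (Sup K) - M (Inf K)) *v f \<xi>)
            \<le> m * ((w (Sup K) - w (Inf K)) + exp (- X) * (v (Sup K) - v (Inf K)))" .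
      qed
      also have "\<dots> = m * ((w 0 - w a) + exp (- X) * V)"
        using additive_tagged_division_1[OF _ p(1), of v] additive_tagged_division_1[OF _ p(1), of w] a
        by (simp add: sum_distrib_left[symmetric] sum.distrib split_def V_def)
      also have "\<dots> \<le> m * \<kappa>"
        using c far by (intro mult_left_mono m) (simp add: w_def)
      finally have "norm (RS_sum M f p) \<le> \<kappa> * m" by (simp add: mult.commute)
      then show "norm I \<le> \<kappa> * m + \<epsilon>"
        using p(3) norm_triangle_ineq4[of "RS_sum M f p" "RS_sum M f p - I"] by simp
    qed
  qed
qed

section \<open>Functional equations with a small delayed functional\<close>

text \<open>\<open>G f\<close> abstracts the inverse of \<open>I - A\<close> applied to the integral
  of \<open>f\<close> against \<open>N\<close>. The axioms concern continuous functions only, where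
  that integral exists. The factor 1/4 leaves room for the fixed point map below, which evaluates
  the functional at two times and so contracts by 1/2.\<close>

locale delayed_functional =
  fixes G :: "(real \<Rightarrow> 'a::banach) \<Rightarrow> 'a" and l :: real
  assumes l: "l > 0"
    and diff: "continuous_on {-1..0} f \<Longrightarrow> continuous_on {-1..0} g \<Longrightarrow> G (\<lambda>\<theta>. f \<theta> - g \<theta>) = G f - G g"
    and small: "continuous_on {-1..0} f \<Longrightarrow> (\<And>\<theta>. \<theta> \<in> {-1..0} \<Longrightarrow> norm (f \<theta>) \<le> m * exp (l * \<theta>)) \<Longrightarrow>
      norm (G f) \<le> m / 4"
begin

definition delayed :: "(real \<Rightarrow> 'a) \<Rightarrow> real \<Rightarrow> 'a" where
  "delayed x t = G (\<lambda>\<theta>. x (t + \<theta>))"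

lemma continuous_on_shift:
  fixes x :: "real \<Rightarrow> 'a"
  assumes "continuous_on {-1..} x" "0 \<le> t"
  shows "continuous_on {-1..0} (\<lambda>\<theta>. x (t + \<theta>))"
  by (rule continuous_on_compose2[OF assms(1)]) (use assms(2) in \<open>auto intro!: continuous_intros\<close>)

text \<open>Functions are total, so dependence on the values in \<open>{-1..0}\<close> alone has to
  be derived: it is \<open>small\<close> with \<open>m = 0\<close>.\<close>

lemma G_cong:
  assumes "continuous_on {-1..0} f" "continuous_on {-1..0} g" "\<And>\<theta>. \<theta> \<in> {-1..0} \<Longrightarrow> f \<theta> = g \<theta>"
  shows "G f = G g"
proof -
  have "norm (G (\<lambda>\<theta>. f \<theta> - g \<theta>)) \<le> 0 / 4"
    using assms by (intro small continuous_on_diff) auto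
  then show ?thesis using diff[OF assms(1,2)] by simp
qed

text \<open>The weight is multiplicative,
  \<open>exp (l * (t + \<theta>)) = exp (l * t) * exp (l * \<theta>)\<close>, so
  \<open>small\<close> applies at every time with \<open>m\<close> scaled by
  \<open>exp (l * t)\<close>. This is the contraction estimate in the weighted norm.\<close>

lemma delayed_diff_le:
  assumes x: "continuous_on {-1..} x" and y: "continuous_on {-1..} y" and t: "0 \<le> t"
    and m: "\<And>s. s \<in> {-1..t} \<Longrightarrow> norm (x s - y s) \<le> m * exp (l * s)"
  shows "norm (delayed x t - delayed y t) \<le> m * exp (l * t) / 4"
proof -
  have "delayed x t - delayed y t = G (\<lambda>\<theta>. x (t + \<theta>) - y (t + \<theta>))"
    using diff[OF continuous_on_shift[OF x t] continuous_on_shift[OF y t]] by (simp add: delayed_def)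
  also have "norm \<dots> \<le> m * exp (l * t) / 4"
  proof (rule small)
    show "continuous_on {-1..0} (\<lambda>\<theta>. x (t + \<theta>) - y (t + \<theta>))"
      by (intro continuous_on_diff continuous_on_shift x y t)
    fix \<theta> :: real assume "\<theta> \<in> {-1..0}"
    then show "norm (x (t + \<theta>) - y (t + \<theta>)) \<le> m * exp (l * t) * exp (l * \<theta>)"
      using m[of "t + \<theta>"] t by (simp add: distrib_left exp_add mult.assoc)
  qed
  finally show ?thesis .
qed

lemma continuous_on_delayed:
  assumes x: "continuous_on {-1..} x"
  shows "continuous_on {0..} (delayed x)"
  unfolding continuous_on_iff
proof (intro ballI allI impI)
  fix t0 \<epsilon> :: real assume t0: "t0 \<in> {0..}" and "\<epsilon> > 0"
  \<comment> \<open>On \<open>{-1..0}\<close> the weight is at least \<open>exp (- l)\<close>, so a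
    uniform bound by \<open>e\<close> is a weighted bound by \<open>\<epsilon>\<close>.\<close>
  define e where "e = \<epsilon> * exp (- l)"
  have e: "e > 0" using \<open>\<epsilon> > 0\<close> by (simp add: e_def)
  have "uniformly_continuous_on {-1..t0 + 1} x"
    by (intro compact_uniformly_continuous continuous_on_subset[OF x]) auto
  then obtain d where d: "d > 0"
    "\<And>s s'. s \<in> {-1..t0 + 1} \<Longrightarrow> s' \<in> {-1..t0 + 1} \<Longrightarrow> dist s' s < d \<Longrightarrow> dist (x s') (x s) < e"
    using e unfolding uniformly_continuous_on_def by blast
  have "dist (delayed x t) (delayed x t0) < \<epsilon>" if t: "t \<in> {0..}" "dist t t0 < min d 1" for t
  proof -
    have c: "continuous_on {-1..0} (\<lambda>\<theta>. x (t + \<theta>))" "continuous_on {-1..0} (\<lambda>\<theta>. x (t0 + \<theta>))"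
      using t t0 by (auto intro: continuous_on_shift x)
    have "norm (G (\<lambda>\<theta>. x (t + \<theta>) - x (t0 + \<theta>))) \<le> \<epsilon> / 4"
    proof (rule small)
      show "continuous_on {-1..0} (\<lambda>\<theta>. x (t + \<theta>) - x (t0 + \<theta>))"
        by (intro continuous_on_diff c)
      fix \<theta> :: real assume \<theta>: "\<theta> \<in> {-1..0}"
      have "t + \<theta> \<in> {-1..t0 + 1}" "t0 + \<theta> \<in> {-1..t0 + 1}" "dist (t + \<theta>) (t0 + \<theta>) < d"
        using \<theta> t t0 by (auto simp: dist_real_def)
      then have "norm (x (t + \<theta>) - x (t0 + \<theta>)) < e" using d(2) by (simp add: dist_norm)
      also have "exp (- l) \<le> exp (l * \<theta>)" using mult_left_mono[of "-1" \<theta> l] \<theta> l by simp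
      then have "e \<le> \<epsilon> * exp (l * \<theta>)" using \<open>\<epsilon> > 0\<close> by (simp add: e_def)
      finally show "norm (x (t + \<theta>) - x (t0 + \<theta>)) \<le> \<epsilon> * exp (l * \<theta>)" by simp
    qed
    then show ?thesis
      using diff[OF c] \<open>\<epsilon> > 0\<close> by (simp add: dist_norm delayed_def)
  qed
  then show "\<exists>d>0. \<forall>t\<in>{0..}. dist t t0 < d \<longrightarrow> dist (delayed x t) (delayed x t0) < \<epsilon>"
    using d(1) by (intro exI[of _ "min d 1"]) auto
qed

text \<open>The weighted difference \<open>h\<close> attains its maximum on the compact interval
  \<open>{-1..T}\<close>. If this happens at a time \<open>t > 0\<close>, the contraction estimate
  gives \<open>h t \<le> h t / 4\<close>; otherwise \<open>h t = 0\<close> by the common initial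
  condition.\<close>

lemma delayed_solution_unique:
  assumes x: "continuous_on {-1..} x" "\<And>t. 0 \<le> t \<Longrightarrow> x t = delayed x t"
    and y: "continuous_on {-1..} y" "\<And>t. 0 \<le> t \<Longrightarrow> y t = delayed y t"
    and eq: "\<And>\<theta>. \<theta> \<in> {-1..0} \<Longrightarrow> x \<theta> = y \<theta>" and T: "-1 \<le> T"
  shows "x T = y T"
proof -
  define h where "h s = exp (- (l * s)) * norm (x s - y s)" for s
  have "continuous_on {-1..T} h"
    unfolding h_def
    by (intro continuous_intros continuous_on_subset[OF x(1)] continuous_on_subset[OF y(1)]) auto
  then obtain t where t: "t \<in> {-1..T}" and max: "\<And>s. s \<in> {-1..T} \<Longrightarrow> h s \<le> h t"
    using continuous_attains_sup[of "{-1..T}" h] T by auto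
  have "h t \<le> 0"
  proof (cases "t \<le> 0")
    case True
    then show ?thesis using eq[of t] t by (simp add: h_def)
  next
    case False
    have "norm (x s - y s) \<le> h t * exp (l * s)" if "s \<in> {-1..t}" for s
    proof -
      have "h s * exp (l * s) \<le> h t * exp (l * s)"
        using max[of s] that t by (intro mult_right_mono) auto
      moreover have "h s * exp (l * s) = norm (x s - y s)"
        by (simp add: h_def exp_minus field_simps)
      ultimately show ?thesis by simp
    qed
    then have "norm (x t - y t) \<le> h t * exp (l * t) / 4"
      using delayed_diff_le[OF x(1) y(1), of t "h t"] x(2)[of t] y(2)[of t] False by simp
    then have "exp (- (l * t)) * norm (x t - y t) \<le> exp (- (l * t)) * (h t * exp (l * t) / 4)"
      by (intro mult_left_mono) auto
    also have "\<dots> = h t / 4" by (simp add: exp_minus field_simps)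
    finally show ?thesis by (simp add: h_def)
  qed
  then have "h T \<le> 0" using max[of T] T by simp
  then show ?thesis by (simp add: h_def mult_le_0_iff)
qed

lemma delayed_solution_exists:
  assumes \<phi>: "continuous_on {-1..0} \<phi>" "\<phi> 0 = G \<phi>"
  obtains x where "continuous_on {-1..} x" "\<forall>\<theta>\<in>{-1..0}. x \<theta> = \<phi> \<theta>"
    "\<forall>t\<ge>0. x t = delayed x t"
proof -
  \<comment> \<open>\<open>z(t) = exp(-l t) x(t)\<close> is bounded. Subtracting \<open>H z 0\<close> makes \<open>T z\<close> continuous for every \<open>z\<close>,
    and at the fixed point it cancels against \<open>\<psi> 0\<close>.\<close>
  define X :: "(real \<Rightarrow>\<^sub>C 'a) \<Rightarrow> real \<Rightarrow> 'a" where "X z s = exp (l * s) *\<^sub>R z s" for z s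
  define H where "H z t = exp (- (l * t)) *\<^sub>R delayed (X z) t" for z t
  \<comment> \<open>Clamping the argument to \<open>{-1..0}\<close> makes \<open>\<psi>\<close>
    bounded and continuous on the whole line, as the space of bounded continuous functions demands.
    For \<open>t \<le> 0\<close> the bracket in \<open>T z t\<close> vanishes, so a fixed point
    starts as \<open>\<phi>\<close>.\<close>
  define \<psi> where "\<psi> t = exp (- (l * max (-1) (min 0 t))) *\<^sub>R \<phi> (max (-1) (min 0 t))" for t
  define T where "T z t = \<psi> t + (H z (max 0 t) - H z 0)" for z t
  have cX: "continuous_on S (X z)" for S z
    unfolding X_def by (intro continuous_intros) auto
  \<comment> \<open>The uniform distance of \<open>z\<close> and \<open>z'\<close> is the weighted
    distance of \<open>X z\<close> and \<open>X z'\<close>, so \<open>delayed_diff_le\<close>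
    applies with \<open>m = dist z z'\<close>.\<close>
  have H_diff: "norm (H z t - H z' t) \<le> dist z z' / 4" if t: "0 \<le> t" for z z' t
  proof -
    have "norm (X z s - X z' s) \<le> dist z z' * exp (l * s)" for s
      using dist_bounded[of z s z'] by (simp add: X_def dist_norm scaleR_diff_right[symmetric])
    then have "norm (delayed (X z) t - delayed (X z') t) \<le> dist z z' * exp (l * t) / 4"
      by (intro delayed_diff_le cX t)
    then have "exp (- (l * t)) * norm (delayed (X z) t - delayed (X z') t)
        \<le> exp (- (l * t)) * (dist z z' * exp (l * t) / 4)"
      by (intro mult_left_mono) auto
    also have "\<dots> = dist z z' / 4" by (simp add: exp_minus field_simps)
    finally show ?thesis by (simp add: H_def scaleR_diff_right[symmetric])
  qed
  \<comment> \<open>Comparison with the zero function, which \<open>H\<close> sends to 0, shows that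
    \<open>T z\<close> is bounded.\<close>
  have H_bound: "norm (H z t) \<le> dist z (const_bcontfun 0) / 4" if t: "0 \<le> t" for z t
  proof -
    have "G (\<lambda>\<theta>. 0) = 0" using diff[of "\<lambda>_. 0" "\<lambda>_. 0"] by simp
    then have "H (const_bcontfun 0) t = 0"
      by (simp add: H_def X_def delayed_def const_bcontfun.rep_eq)
    then show ?thesis using H_diff[OF t, of z "const_bcontfun 0"] by simp
  qed
  have c\<psi>: "continuous_on UNIV \<psi>"
    unfolding \<psi>_def
    by (intro continuous_intros continuous_on_compose2[OF \<phi>(1)]) auto
  have b\<psi>: "bounded (range \<psi>)"
  proof -
    have "bounded ((\<lambda>s. exp (- (l * s)) *\<^sub>R \<phi> s) ` {-1..0})"
      by (intro compact_imp_bounded compact_continuous_image continuous_intros \<phi>(1)) auto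
    moreover have "range \<psi> \<subseteq> (\<lambda>s. exp (- (l * s)) *\<^sub>R \<phi> s) ` {-1..0}"
      by (auto simp: \<psi>_def)
    ultimately show ?thesis by (rule bounded_subset)
  qed
  have "T z \<in> bcontfun" for z
  proof -
    have "continuous_on {0..} (H z)"
      unfolding H_def by (intro continuous_intros continuous_on_delayed cX)
    then have "continuous_on UNIV (\<lambda>t. H z (max 0 t))"
      by (rule continuous_on_compose2) (auto intro!: continuous_intros)
    then have "continuous_on UNIV (T z)"
      unfolding T_def by (intro continuous_intros c\<psi>)
    moreover have "bounded (range (T z))"
    proof -
      obtain B where B: "\<And>t. norm (\<psi> t) \<le> B" using b\<psi> by (auto simp: bounded_iff)
      have "norm (T z t) \<le> B + (dist z (const_bcontfun 0) / 4 + dist z (const_bcontfun 0) / 4)" for t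
        unfolding T_def
        by (intro norm_triangle_mono norm_triangle_le_diff add_mono B H_bound) auto
      then show ?thesis by (auto simp: bounded_iff)
    qed
    ultimately show ?thesis by (simp add: bcontfun_def)
  qed
  then have app: "apply_bcontfun (Bcontfun (T z)) = T z" for z
    by (rule Bcontfun_inverse)
  have "dist (Bcontfun (T z)) (Bcontfun (T z')) \<le> 1/2 * dist z z'" for z z'
  proof (rule dist_bound)
    fix t
    have "norm (T z t - T z' t) = norm ((H z (max 0 t) - H z' (max 0 t)) - (H z 0 - H z' 0))"
      by (simp add: T_def algebra_simps)
    also have "\<dots> \<le> norm (H z (max 0 t) - H z' (max 0 t)) + norm (H z 0 - H z' 0)"
      by (rule norm_triangle_ineq4)
    also have "\<dots> \<le> dist z z' / 4 + dist z z' / 4"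
      by (intro add_mono H_diff) auto
    finally show "dist (Bcontfun (T z) t) (Bcontfun (T z') t) \<le> 1/2 * dist z z'"
      by (simp add: app dist_norm)
  qed
  then have "\<exists>!z. Bcontfun (T z) = z"
    by (intro banach_fix_type[of "1/2"]) auto
  then obtain z where "Bcontfun (T z) = z" by blast
  then have z: "z t = T z t" for t using app[of z] by simp
  have init: "X z \<theta> = \<phi> \<theta>" if "\<theta> \<in> {-1..0}" for \<theta>
  proof -
    have "max (-1) (min 0 \<theta>) = \<theta>" "max 0 \<theta> = 0" using that by auto
    then show ?thesis using z[of \<theta>] by (simp add: X_def T_def \<psi>_def exp_minus)
  qed
  \<comment> \<open>The compatibility condition \<open>\<phi> 0 = G \<phi>\<close> enters here: it
    identifies \<open>H z 0\<close> with \<open>\<psi> 0\<close>, which turns the fixed point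
    equation into \<open>z t = H z t\<close> for \<open>t \<ge> 0\<close>.\<close>
  have "delayed (X z) 0 = G \<phi>"
    unfolding delayed_def by (rule G_cong) (use init \<phi>(1) cX in auto)
  then have H0: "H z 0 = \<psi> 0" using \<phi>(2) by (simp add: H_def \<psi>_def)
  have "X z t = delayed (X z) t" if "0 \<le> t" for t
  proof -
    have "\<psi> t = \<psi> 0" using that by (simp add: \<psi>_def)
    then have "z t = H z t" using z[of t] H0 that by (simp add: T_def)
    then show ?thesis by (simp add: X_def H_def exp_minus)
  qed
  with cX init show thesis by (intro that[of "X z"] ballI allI impI)
qed

end

section \<open>Application to the neutral term: inverting \<open>I - A\<close>\<close>

theorem proposition6:
  fixes M :: "real \<Rightarrow> real^'n^'n"
  assumes "\<forall>t\<in>{-1<..<0}. continuous (at_right t) M"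
    and "M \<in> class_W"
  shows "\<forall>\<phi>\<in>admissible_initial M.
    (\<exists>x. global_solution M x \<and> has_initial_condition x \<phi> \<and>
      (\<forall>y. global_solution M y \<and> has_initial_condition y \<phi> \<longrightarrow> (\<forall>t\<ge>-1. y t = x t)))"
proof -
  have bv: "bounded_variation_on (-1) 0 M" and det: "det (mat 1 - jump_at_0 M) \<noteq> 0"
    using assms(2) by (auto simp: class_W_def)
  obtain v0 where v0: "dominated_on (-1) 0 M v0"
    by (rule bounded_variation_dominated[OF bv])
  obtain M0 where M0: "(M \<longlongrightarrow> M0) (at_left 0)"
    by (rule dominated_on_left_limit[OF _ v0]) auto
  obtain l0 where l0: "(v0 \<longlongrightarrow> l0) (at_left 0)"
    by (rule mono_left_limit[of "-1" 0 v0]) (auto intro: dominated_on_mono[OF v0])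
  define A where "A = jump_at_0 M"
  have "Lim (at_left 0) M = M0"
    by (rule tendsto_Lim[OF trivial_limit_at_left_real M0])
  then have A: "A = M 0 - M0" by (simp add: A_def jump_at_0_def)
  define N where "N = M(0 := M0)"
  define v where "v = v0(0 := l0)"
  have dom: "dominated_on (-1) 0 N v"
    unfolding N_def v_def by (rule dominated_on_update_right[OF v0 M0 l0])
  have "(v \<longlongrightarrow> l0) (at_left 0)"
    by (rule Lim_transform_eventually[OF l0]) (auto simp: v_def eventually_at_filter)
  then have v: "(v \<longlongrightarrow> v 0) (at_left 0)" by (simp add: v_def)
  have M_split: "M = (\<lambda>t. N t + (if t = 0 then A else 0))"
    by (auto simp: N_def A)
  obtain B where B: "B ** (mat 1 - A) = mat 1" "(mat 1 - A) ** B = mat 1"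
    using det by (auto simp: A_def invertible_det_nz[symmetric] invertible_def)
  obtain C where C: "C > 0" "\<And>u. norm (B *v u) \<le> norm u * C"
    using bounded_linear.pos_bounded[OF matrix_vector_mul_bounded_linear[of B]] by blast
  \<comment> \<open>\<open>C\<close> bounds the norm of \<open>B\<close>, the inverse of
    \<open>I - A\<close>; the factor \<open>1 / (4 * C)\<close> for the integral becomes 1/4 after
    applying \<open>B\<close>.\<close>
  have "(-1::real) < 0" "1 / (4 * C) > 0" using C(1) by simp_all
  then obtain l where l: "l > 0" and
    weight: "\<forall>f I m. has_RS_integral (-1) 0 N f I \<longrightarrow>
      (\<forall>\<theta>\<in>{-1..0}. norm (f \<theta>) \<le> m * exp (l * \<theta>)) \<longrightarrow> norm I \<le> 1 / (4 * C) * m"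
    by (rule has_RS_integral_exp_weight[OF _ dom v])
  define J where "J f = (THE I. has_RS_integral (-1) 0 N f I)" for f
  have J: "has_RS_integral (-1) 0 N f (J f)" if f: "continuous_on {-1..0} f" for f
  proof -
    obtain I where I: "has_RS_integral (-1) 0 N f I"
      using has_RS_integral_exists[OF _ dom f] by auto
    then have "J f = I"
      unfolding J_def by (rule the_equality) (rule has_RS_integral_unique[OF _ I])
    with I show ?thesis by simp
  qed
  have J_unique: "J f = I" if "continuous_on {-1..0} f" "has_RS_integral (-1) 0 N f I" for f I
    by (rule has_RS_integral_unique[OF J]) fact+
  \<comment> \<open>The jump contributes \<open>A *v f 0\<close> to the integral. By uniqueness of
    the integral the equation says \<open>(I - A) f(0) = J f\<close>, and \<open>B\<close> inverts
    the left factor. The same equivalence serves the admissibility of \<open>\<phi>\<close> and the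
    equation at each \<open>t \<ge> 0\<close>.\<close>
  have equation_iff: "has_RS_integral (-1) 0 M f (f 0) \<longleftrightarrow> f 0 = B *v J f"
    if f: "continuous_on {-1..0} f" for f
  proof -
    have int: "has_RS_integral (-1) 0 M f (J f + A *v f 0)"
      by (subst M_split, intro has_RS_integral_add_integrator J f has_RS_integral_right_jump) auto
    have "has_RS_integral (-1) 0 M f (f 0) \<longleftrightarrow> f 0 = J f + A *v f 0"
      using has_RS_integral_unique[OF int] int by metis
    also have "\<dots> \<longleftrightarrow> (mat 1 - A) *v f 0 = J f"
      by (auto simp: matrix_vector_mult_diff_rdistrib algebra_simps)
    also have "\<dots> \<longleftrightarrow> f 0 = B *v J f"
      using B by (metis matrix_vector_mul_assoc matrix_vector_mul_lid)
    finally show ?thesis .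
  qed
  interpret delayed_functional "\<lambda>f. B *v J f" l
  proof
    show "l > 0" by (rule l)
  next
    fix f g :: "real \<Rightarrow> real^'n"
    assume c: "continuous_on {-1..0} f" "continuous_on {-1..0} g"
    have "J (\<lambda>\<theta>. f \<theta> - g \<theta>) = J f - J g"
      by (intro J_unique continuous_on_diff has_RS_integral_diff J c)
    then show "B *v J (\<lambda>\<theta>. f \<theta> - g \<theta>) = B *v J f - B *v J g"
      by (simp add: matrix_vector_mult_diff_distrib)
  next
    fix f :: "real \<Rightarrow> real^'n" and m :: real
    assume f: "continuous_on {-1..0} f" "\<And>\<theta>. \<theta> \<in> {-1..0} \<Longrightarrow> norm (f \<theta>) \<le> m * exp (l * \<theta>)"
    have "norm (B *v J f) \<le> norm (J f) * C" by (rule C(2))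
    also have "\<dots> \<le> (1 / (4 * C) * m) * C"
      using weight[rule_format, OF J[OF f(1)] f(2)] C(1) by (intro mult_right_mono) auto
    also have "\<dots> = m / 4" using C(1) by simp
    finally show "norm (B *v J f) \<le> m / 4" .
  qed
  have global_iff: "global_solution M x \<longleftrightarrow> continuous_on {-1..} x \<and> (\<forall>t\<ge>0. x t = delayed x t)" for x
  proof -
    have "has_RS_integral (-1) 0 M (\<lambda>\<theta>. x (t + \<theta>)) (x t) \<longleftrightarrow> x t = delayed x t"
      if "continuous_on {-1..} x" "0 \<le> t" for t
      using equation_iff[OF continuous_on_shift[OF that]] by (simp add: delayed_def)
    then show ?thesis by (auto simp: global_solution_def)
  qed
  show ?thesis
  proof
    fix \<phi> assume "\<phi> \<in> admissible_initial M"
    then have \<phi>: "continuous_on {-1..0} \<phi>" "has_RS_integral (-1) 0 M \<phi> (\<phi> 0)"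
      by (auto simp: admissible_initial_def)
    then have "\<phi> 0 = B *v J \<phi>" using equation_iff by blast
    with \<phi>(1) obtain x where x: "continuous_on {-1..} x" "\<forall>\<theta>\<in>{-1..0}. x \<theta> = \<phi> \<theta>"
        "\<forall>t\<ge>0. x t = delayed x t"
      by (rule delayed_solution_exists)
    show "\<exists>x. global_solution M x \<and> has_initial_condition x \<phi> \<and>
      (\<forall>y. global_solution M y \<and> has_initial_condition y \<phi> \<longrightarrow> (\<forall>t\<ge>-1. y t = x t))"
    proof (intro exI[of _ x] conjI allI impI)
      show "global_solution M x" using x by (simp add: global_iff)
      show "has_initial_condition x \<phi>" using x by (simp add: has_initial_condition_def)
      fix y and t :: real assume "global_solution M y \<and> has_initial_condition y \<phi>" and t: "-1 \<le> t"
      then have y: "continuous_on {-1..} y" "\<And>s. 0 \<le> s \<Longrightarrow> y s = delayed y s"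
          "\<And>\<theta>. \<theta> \<in> {-1..0} \<Longrightarrow> y \<theta> = x \<theta>"
        using x(2) by (simp_all add: global_iff has_initial_condition_def)
      show "y t = x t"
        by (rule delayed_solution_unique[OF y(1,2) x(1) x(3)[rule_format] y(3) t])
    qed
  qed
qed

end
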